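(* Let $\mathcal{A}=\bigcup_p\Phi_p'$ be a unital strong algebra, with associated constants $d$ and $A_{p,q}$ (as defined in the context). Let $a\in\mathcal{A}$ be such that there exist $p,q$ with $p>q+d$ and $A_{p,q}\|a\|_q<1$. Then $1-a$ is invertible (from both sides) and it holds that $$\|(1-a)^{-1}\|_p\le\frac{1}{1-A_{p,q}\|a\|_q},\qquad \|1-(1-a)^{-1}\|_p\le\frac{A_{p,q}\|a\|_q}{1-A_{p,q}\|a\|_q}.$$
   Context: A countably normed space $\Phi$ is a locally convex (complex) space whose topology is defined by a countable family of compatible norms $(\|\cdot\|_p)_{p\in\mathbb N}$, i.e. if a sequence that is Cauchy in both $\|\cdot\|_p$ and $\|\cdot\|_q$ converges to zero in one of these norms, then it converges to zero in the other; the sequence of norms is taken non-decreasing in $p$. $\Phi_p$ denotes the completion of $\Phi$ with respect to $\|\cdot\|_p$, so $\Phi_1\supseteq\Phi_2\supseteq\cdots$, and $\Phi$ is complete iff $\Phi=\bigcap_p\Phi_p$. $\Phi'$ is the dual of $\Phi$ and $\Phi_p'$ the Banach dual of $\Phi_p$, with norm $\|f\|_p=\sup_{\|x\|_p\le 1}|f(x)|$; then $\Phi_1'\subseteq\Phi_2'\subseteq\cdots$, $\Phi'=\bigcup_p\Phi_p'$, and these dual norms are non-increasing in $p$. Strong algebra: a dual $\mathcal A=\bigcup_p\Phi_p'$ of a complete reflexive countably normed space $\Phi$, which is moreover an algebra over $\mathbb C$, such that there exists a constant $d$ such that for any $q$ and any $p>q+d$ there exists a positive constant $A_{p,q}$ such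 that for any $a\in\Phi_q'$ and $b\in\Phi_p'$: $\|ab\|_p\le A_{p,q}\|a\|_q\|b\|_p$ and $\|ba\|_p\le A_{p,q}\|a\|_q\|b\|_p$. Unital means that $\mathcal A$ has a multiplicative unit $1$. A condition such as $A_{p,q}\|a\|_q<1$ includes the requirement $a\in\Phi_q'$.
   Formalization: The two norm bounds are asserted only when 1 lies in Φ_p' and ‖1‖_p ≤ 1 (without this they fail already for a = 0); two-sided invertibility of 1−a is asserted without it. The constant d is read as a natural number. *)

theory Defs
  imports "HOL-Analysis.Analysis" "HOL-Library.Function_Algebras"
begin

text \<open>
  HOL-Analysis has no class of complex vector spaces, so the scalar multiplication
  \<open>smul :: complex \<Rightarrow> 'a \<Rightarrow> 'a\<close> of the space \<open>\<Phi>\<close> is a parameter, governed by the locale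
  \<^locale>\<open>vector_space\<close>.  The whole type \<open>'a\<close> is the carrier of \<open>\<Phi>\<close>.  Sums and differences of
  functionals are pointwise.
\<close>


section \<open>Countably normed spaces\<close>

definition is_norm :: "(complex \<Rightarrow> 'a \<Rightarrow> 'a) \<Rightarrow> ('a::ab_group_add \<Rightarrow> real) \<Rightarrow> bool" where
  "is_norm smul N \<longleftrightarrow>
     (\<forall>x. 0 \<le> N x) \<and> (\<forall>x. N x = 0 \<longleftrightarrow> x = 0) \<and>
     (\<forall>x y. N (x + y) \<le> N x + N y) \<and> (\<forall>c x. N (smul c x) = cmod c * N x)"

definition cauchy_wrt :: "('a::ab_group_add \<Rightarrow> real) \<Rightarrow> (nat \<Rightarrow> 'a) \<Rightarrow> bool" where
  "cauchy_wrt N X \<longleftrightarrow> (\<forall>e>0. \<exists>M. \<forall>m\<ge>M. \<forall>n\<ge>M. N (X m - X n) < e)"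

definition converges_wrt :: "('a::ab_group_add \<Rightarrow> real) \<Rightarrow> (nat \<Rightarrow> 'a) \<Rightarrow> 'a \<Rightarrow> bool" where
  "converges_wrt N X x \<longleftrightarrow> (\<lambda>n. N (X n - x)) \<longlonglongrightarrow> 0"

definition compatible_norms :: "('a::ab_group_add \<Rightarrow> real) \<Rightarrow> ('a \<Rightarrow> real) \<Rightarrow> bool" where
  "compatible_norms N N' \<longleftrightarrow>
     (\<forall>X. cauchy_wrt N X \<longrightarrow> cauchy_wrt N' X \<longrightarrow> (converges_wrt N X 0 \<longleftrightarrow> converges_wrt N' X 0))"

definition countably_normed_space ::
  "(complex \<Rightarrow> 'a \<Rightarrow> 'a) \<Rightarrow> (nat \<Rightarrow> 'a::ab_group_add \<Rightarrow> real) \<Rightarrow> bool" where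
  "countably_normed_space smul nrm \<longleftrightarrow>
     vector_space smul \<and> (\<forall>p. is_norm smul (nrm p)) \<and>
     (\<forall>p q. compatible_norms (nrm p) (nrm q)) \<and> (\<forall>p x. nrm p x \<le> nrm (Suc p) x)"

definition cn_topology :: "(nat \<Rightarrow> 'a::ab_group_add \<Rightarrow> real) \<Rightarrow> 'a topology" where
  "cn_topology nrm = topology_generated_by {{y. nrm p (y - x) < r} | p x r. 0 < r}"

text \<open>The topology is metrizable, so completeness is sequential; a sequence is Cauchy (convergent)
  iff it is so for each of the norms, with the same limit.\<close>

definition cn_complete :: "(nat \<Rightarrow> 'a::ab_group_add \<Rightarrow> real) \<Rightarrow> bool" where
  "cn_complete nrm \<longleftrightarrow>
     (\<forall>X. (\<forall>p. cauchy_wrt (nrm p) X) \<longrightarrow> (\<exists>x. \<forall>p. converges_wrt (nrm p) X x))"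


section \<open>Strong duals and reflexivity\<close>

text \<open>
  Here \<open>T\<close> is a vector topology on the carrier \<open>topspace T\<close>, which need not be the whole type (it
  is a proper subset when \<open>T\<close> is itself the topology of a dual space).  Functionals are set to \<open>0\<close>
  outside the carrier, so that distinct elements of the dual are distinct functions.
\<close>

definition topological_dual ::
  "(complex \<Rightarrow> 'v \<Rightarrow> 'v) \<Rightarrow> 'v::ab_group_add topology \<Rightarrow> ('v \<Rightarrow> complex) set" where
  "topological_dual smul T =
     {f. (\<forall>x\<in>topspace T. \<forall>y\<in>topspace T. f (x + y) = f x + f y) \<and>
         (\<forall>c. \<forall>x\<in>topspace T. f (smul c x) = c * f x) \<and>
         (\<forall>x. x \<notin> topspace T \<longrightarrow> f x = 0) \<and>
         continuous_map T euclidean f}"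

definition bounded_in ::
  "(complex \<Rightarrow> 'v \<Rightarrow> 'v) \<Rightarrow> 'v::ab_group_add topology \<Rightarrow> 'v set \<Rightarrow> bool" where
  "bounded_in smul T B \<longleftrightarrow>
     B \<subseteq> topspace T \<and>
     (\<forall>U. openin T U \<and> 0 \<in> U \<longrightarrow> (\<exists>r>0. \<forall>c. r \<le> cmod c \<longrightarrow> B \<subseteq> smul c ` U))"

text \<open>
  Uniform convergence on bounded sets.  The generating sets are the open balls of the seminorms
  \<open>g \<mapsto> sup\<^sub>B \<bar>g\<bar>\<close>: the condition with \<open>\<delta> < \<epsilon>\<close> says that the supremum of \<open>\<bar>g - f\<bar>\<close> over \<open>B\<close> is
  less than \<open>\<epsilon>\<close> (also for empty \<open>B\<close>).
\<close>

definition strong_dual_topology ::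
  "(complex \<Rightarrow> 'v \<Rightarrow> 'v) \<Rightarrow> 'v::ab_group_add topology \<Rightarrow> ('v \<Rightarrow> complex) topology" where
  "strong_dual_topology smul T =
     topology_generated_by
       {{g \<in> topological_dual smul T. \<exists>\<delta><\<epsilon>. \<forall>x\<in>B. cmod (g x - f x) \<le> \<delta>} | f B \<epsilon>.
          f \<in> topological_dual smul T \<and> bounded_in smul T B \<and> 0 < \<epsilon>}"

definition fun_scale :: "complex \<Rightarrow> ('v \<Rightarrow> complex) \<Rightarrow> ('v \<Rightarrow> complex)" where
  "fun_scale c f = (\<lambda>x. c * f x)"

definition canonical_embedding ::
  "(complex \<Rightarrow> 'v \<Rightarrow> 'v) \<Rightarrow> 'v::ab_group_add topology \<Rightarrow> 'v \<Rightarrow> ('v \<Rightarrow> complex) \<Rightarrow> complex" where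
  "canonical_embedding smul T x = (\<lambda>f. if f \<in> topological_dual smul T then f x else 0)"

definition reflexive_space :: "(complex \<Rightarrow> 'v \<Rightarrow> 'v) \<Rightarrow> 'v::ab_group_add topology \<Rightarrow> bool" where
  "reflexive_space smul T \<longleftrightarrow>
     homeomorphic_map T
       (strong_dual_topology fun_scale (strong_dual_topology smul T))
       (canonical_embedding smul T)"


section \<open>The completions \<open>\<Phi>\<^sub>p\<close> and their Banach duals\<close>

text \<open>The completion of \<open>(\<Phi>, N)\<close> consists of the classes of Cauchy sequences modulo null
  sequences.\<close>

definition completion_rel :: "('a::ab_group_add \<Rightarrow> real) \<Rightarrow> ((nat \<Rightarrow> 'a) \<times> (nat \<Rightarrow> 'a)) set" where
  "completion_rel N = {(X, Y). cauchy_wrt N X \<and> cauchy_wrt N Y \<and> (\<lambda>n. N (X n - Y n)) \<longlonglongrightarrow> 0}"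

definition completion :: "('a::ab_group_add \<Rightarrow> real) \<Rightarrow> (nat \<Rightarrow> 'a) set set" where
  "completion N = {X. cauchy_wrt N X} // completion_rel N"

definition completion_embed :: "('a::ab_group_add \<Rightarrow> real) \<Rightarrow> 'a \<Rightarrow> (nat \<Rightarrow> 'a) set" where
  "completion_embed N x = completion_rel N `` {\<lambda>_. x}"

definition completion_add ::
  "('a::ab_group_add \<Rightarrow> real) \<Rightarrow> (nat \<Rightarrow> 'a) set \<Rightarrow> (nat \<Rightarrow> 'a) set \<Rightarrow> (nat \<Rightarrow> 'a) set" where
  "completion_add N \<xi> \<eta> = (\<Union>X\<in>\<xi>. \<Union>Y\<in>\<eta>. completion_rel N `` {\<lambda>n. X n + Y n})"

definition completion_scale ::
  "(complex \<Rightarrow> 'a \<Rightarrow> 'a) \<Rightarrow> ('a::ab_group_add \<Rightarrow> real) \<Rightarrow> complex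
     \<Rightarrow> (nat \<Rightarrow> 'a) set \<Rightarrow> (nat \<Rightarrow> 'a) set" where
  "completion_scale smul N c \<xi> = (\<Union>X\<in>\<xi>. completion_rel N `` {\<lambda>n. smul c (X n)})"

definition completion_norm :: "('a::ab_group_add \<Rightarrow> real) \<Rightarrow> (nat \<Rightarrow> 'a) set \<Rightarrow> real" where
  "completion_norm N \<xi> = (THE r. \<forall>X\<in>\<xi>. (\<lambda>n. N (X n)) \<longlonglongrightarrow> r)"

definition completion_dual ::
  "(complex \<Rightarrow> 'a \<Rightarrow> 'a) \<Rightarrow> ('a::ab_group_add \<Rightarrow> real) \<Rightarrow> ((nat \<Rightarrow> 'a) set \<Rightarrow> complex) set" where
  "completion_dual smul N =
     {g. (\<forall>\<xi>\<in>completion N. \<forall>\<eta>\<in>completion N. g (completion_add N \<xi> \<eta>) = g \<xi> + g \<eta>) \<and>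
         (\<forall>c. \<forall>\<xi>\<in>completion N. g (completion_scale smul N c \<xi>) = c * g \<xi>) \<and>
         (\<exists>C. \<forall>\<xi>\<in>completion N. cmod (g \<xi>) \<le> C * completion_norm N \<xi>)}"

text \<open>
  The inclusions \<open>\<Phi>\<^sub>p' \<subseteq> \<Phi>\<^sub>p\<^sub>+\<^sub>1' \<subseteq> \<Phi>'\<close> identify a functional on \<open>\<Phi>\<^sub>p\<close> with its restriction to the
  dense subspace \<open>\<Phi>\<close>.  Thus \<open>banach_dual smul (nrm p)\<close> is \<open>\<Phi>\<^sub>p'\<close> as a set of functionals on \<open>\<Phi>\<close>,
  and the norm of \<open>f\<close> is that of its extension \<open>g\<close> to \<open>\<Phi>\<^sub>p\<close>, which is unique by density.
  The value of \<open>dual_norm\<close> outside \<open>banach_dual\<close> is meaningless.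
\<close>

definition banach_dual ::
  "(complex \<Rightarrow> 'a \<Rightarrow> 'a) \<Rightarrow> ('a::ab_group_add \<Rightarrow> real) \<Rightarrow> ('a \<Rightarrow> complex) set" where
  "banach_dual smul N = (\<lambda>g x. g (completion_embed N x)) ` completion_dual smul N"

definition dual_norm ::
  "(complex \<Rightarrow> 'a \<Rightarrow> 'a) \<Rightarrow> ('a::ab_group_add \<Rightarrow> real) \<Rightarrow> ('a \<Rightarrow> complex) \<Rightarrow> real" where
  "dual_norm smul N f =
     Sup {cmod (g \<xi>) | g \<xi>. g \<in> completion_dual smul N \<and> f = (\<lambda>x. g (completion_embed N x)) \<and>
                            \<xi> \<in> completion N \<and> completion_norm N \<xi> \<le> 1}"


section \<open>Strong algebras\<close>

definition dual_union ::
  "(complex \<Rightarrow> 'a \<Rightarrow> 'a) \<Rightarrow> (nat \<Rightarrow> 'a::ab_group_add \<Rightarrow> real) \<Rightarrow> ('a \<Rightarrow> complex) set" where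
  "dual_union smul nrm = (\<Union>p. banach_dual smul (nrm p))"

definition algebra_product ::
  "('v \<Rightarrow> complex) set \<Rightarrow> (('v \<Rightarrow> complex) \<Rightarrow> ('v \<Rightarrow> complex) \<Rightarrow> ('v \<Rightarrow> complex)) \<Rightarrow> bool" where
  "algebra_product S mul \<longleftrightarrow>
     (\<forall>a\<in>S. \<forall>b\<in>S. mul a b \<in> S) \<and>
     (\<forall>a\<in>S. \<forall>b\<in>S. \<forall>c\<in>S. mul (mul a b) c = mul a (mul b c)) \<and>
     (\<forall>a\<in>S. \<forall>b\<in>S. \<forall>c\<in>S. mul (a + b) c = mul a c + mul b c \<and> mul a (b + c) = mul a b + mul a c) \<and>
     (\<forall>z. \<forall>a\<in>S. \<forall>b\<in>S. mul (fun_scale z a) b = fun_scale z (mul a b) \<and>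
                          mul a (fun_scale z b) = fun_scale z (mul a b))"

text \<open>\<open>d\<close> and \<open>A\<close> are the constants associated with the strong algebra; \<open>A p q\<close> is relevant only
  for \<open>p > q + d\<close>.\<close>

definition strong_algebra ::
  "(complex \<Rightarrow> 'a \<Rightarrow> 'a) \<Rightarrow> (nat \<Rightarrow> 'a::ab_group_add \<Rightarrow> real)
     \<Rightarrow> (('a \<Rightarrow> complex) \<Rightarrow> ('a \<Rightarrow> complex) \<Rightarrow> ('a \<Rightarrow> complex)) \<Rightarrow> nat \<Rightarrow> (nat \<Rightarrow> nat \<Rightarrow> real) \<Rightarrow> bool" where
  "strong_algebra smul nrm mul d A \<longleftrightarrow>
     countably_normed_space smul nrm \<and> cn_complete nrm \<and>
     reflexive_space smul (cn_topology nrm) \<and>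
     algebra_product (dual_union smul nrm) mul \<and>
     (\<forall>q p. p > q + d \<longrightarrow> A p q > 0 \<and>
        (\<forall>a\<in>banach_dual smul (nrm q). \<forall>b\<in>banach_dual smul (nrm p).
           mul a b \<in> banach_dual smul (nrm p) \<and> mul b a \<in> banach_dual smul (nrm p) \<and>
           dual_norm smul (nrm p) (mul a b)
             \<le> A p q * dual_norm smul (nrm q) a * dual_norm smul (nrm p) b \<and>
           dual_norm smul (nrm p) (mul b a)
             \<le> A p q * dual_norm smul (nrm q) a * dual_norm smul (nrm p) b))"

definition algebra_unit ::
  "('v \<Rightarrow> complex) set \<Rightarrow> (('v \<Rightarrow> complex) \<Rightarrow> ('v \<Rightarrow> complex) \<Rightarrow> ('v \<Rightarrow> complex))
     \<Rightarrow> ('v \<Rightarrow> complex) \<Rightarrow> bool" where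
  "algebra_unit S mul e \<longleftrightarrow> e \<in> S \<and> (\<forall>a\<in>S. mul e a = a \<and> mul a e = a)"

end

theory Submission
  imports Defs
begin

text \<open>
  Multiplication by \<open>a\<close>, on either side, maps the Banach space \<open>\<Phi>\<^sub>p'\<close> to itself with norm at most
  \<open>k = A p q * \<parallel>a\<parallel>\<^sub>q < 1\<close>.  The Neumann series of these two operators, applied to
  \<open>a \<in> \<Phi>\<^sub>q' \<subseteq> \<Phi>\<^sub>p'\<close>, yield \<open>s = a + a s\<close> and \<open>s' = a + s' a\<close> in \<open>\<Phi>\<^sub>p'\<close>, so \<open>e + s\<close> is a right and
  \<open>e + s'\<close> a left inverse of \<open>e - a\<close>, and the two agree.  Starting the series at \<open>a\<close> rather than at
  the unit makes this work even if \<open>e \<notin> \<Phi>\<^sub>p'\<close>.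
\<close>

section \<open>A single norm and its Cauchy sequences\<close>

locale complex_norm = vector_space smul
  for smul :: "complex \<Rightarrow> 'a \<Rightarrow> 'a::ab_group_add" +
  fixes N :: "'a \<Rightarrow> real"
  assumes is_norm: "is_norm smul N"
begin

abbreviation cls :: "(nat \<Rightarrow> 'a) \<Rightarrow> (nat \<Rightarrow> 'a) set" where
  "cls X \<equiv> completion_rel N `` {X}"

abbreviation dn :: "('a \<Rightarrow> complex) \<Rightarrow> real" where
  "dn \<equiv> dual_norm smul N"

abbreviation BD :: "('a \<Rightarrow> complex) set" where
  "BD \<equiv> banach_dual smul N"

lemma N_nonneg [simp]: "0 \<le> N x"
  and N_eq_0_iff [simp]: "N x = 0 \<longleftrightarrow> x = 0"
  and N_triangle: "N (x + y) \<le> N x + N y"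
  and N_scale: "N (smul c x) = cmod c * N x"
  using is_norm by (auto simp: is_norm_def)

lemma N_zero [simp]: "N 0 = 0"
  by simp

lemma N_minus: "N (- x) = N x"
  using N_scale[of "-1" x] by (simp add: scale_minus_left)

lemma N_diff_commute: "N (x - y) = N (y - x)"
  using N_minus[of "x - y"] by simp

lemma N_diff_triangle: "N (x - z) \<le> N (x - y) + N (y - z)"
  using N_triangle[of "x - y" "y - z"] by simp

lemma N_reverse_triangle: "\<bar>N x - N y\<bar> \<le> N (x - y)"
  using N_triangle[of "x - y" y] N_triangle[of "y - x" x] N_diff_commute[of x y] by simp

lemma cauchy_const: "cauchy_wrt N (\<lambda>_. x)"
  by (simp add: cauchy_wrt_def)

lemma cauchy_add:
  assumes "cauchy_wrt N X" "cauchy_wrt N Y"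
  shows "cauchy_wrt N (\<lambda>n. X n + Y n)"
  unfolding cauchy_wrt_def
proof (intro allI impI)
  fix \<epsilon> :: real assume "\<epsilon> > 0"
  then obtain M1 M2 where M: "\<And>m n. m \<ge> M1 \<Longrightarrow> n \<ge> M1 \<Longrightarrow> N (X m - X n) < \<epsilon> / 2"
      "\<And>m n. m \<ge> M2 \<Longrightarrow> n \<ge> M2 \<Longrightarrow> N (Y m - Y n) < \<epsilon> / 2"
    using assms unfolding cauchy_wrt_def by (meson half_gt_zero)
  have "N (X m + Y m - (X n + Y n)) < \<epsilon>" if "m \<ge> max M1 M2" "n \<ge> max M1 M2" for m n
    using M(1)[of m n] M(2)[of m n] N_triangle[of "X m - X n" "Y m - Y n"] that
    by (simp add: algebra_simps)
  then show "\<exists>M. \<forall>m\<ge>M. \<forall>n\<ge>M. N (X m + Y m - (X n + Y n)) < \<epsilon>" by blast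
qed

lemma cauchy_scale:
  assumes "cauchy_wrt N X"
  shows "cauchy_wrt N (\<lambda>n. smul c (X n))"
  unfolding cauchy_wrt_def
proof (intro allI impI)
  fix \<epsilon> :: real assume "\<epsilon> > 0"
  \<comment> \<open>Adding 1 to the modulus keeps the denominator positive when c = 0.\<close>
  then have "\<epsilon> / (cmod c + 1) > 0" by (simp add: add_nonneg_pos)
  then obtain M where M: "\<And>m n. m \<ge> M \<Longrightarrow> n \<ge> M \<Longrightarrow> N (X m - X n) < \<epsilon> / (cmod c + 1)"
    using assms unfolding cauchy_wrt_def by meson
  have "N (smul c (X m) - smul c (X n)) < \<epsilon>" if "m \<ge> M" "n \<ge> M" for m n
  proof -
    have "N (smul c (X m) - smul c (X n)) = cmod c * N (X m - X n)"
      by (simp add: N_scale flip: scale_right_diff_distrib)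
    also have "\<dots> \<le> (cmod c + 1) * N (X m - X n)"
      by (simp add: mult_right_mono)
    also have "\<dots> < \<epsilon>"
      using M[OF that] by (simp add: less_divide_eq add_nonneg_pos mult.commute)
    finally show ?thesis .
  qed
  then show "\<exists>M. \<forall>m\<ge>M. \<forall>n\<ge>M. N (smul c (X m) - smul c (X n)) < \<epsilon>" by blast
qed

lemma cauchy_norm_convergent:
  assumes "cauchy_wrt N X"
  shows "convergent (\<lambda>n. N (X n))"
proof -
  have "Cauchy (\<lambda>n. N (X n))"
    unfolding Cauchy_def dist_real_def
    using assms N_reverse_triangle unfolding cauchy_wrt_def by (meson le_less_trans)
  then show ?thesis by (simp add: real_Cauchy_convergent)
qed

section \<open>The completion as a space of classes of Cauchy sequences\<close>

lemma equiv_completion_rel: "equiv {X. cauchy_wrt N X} (completion_rel N)"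
proof (rule equivI)
  show "completion_rel N \<subseteq> {X. cauchy_wrt N X} \<times> {X. cauchy_wrt N X}"
    by (auto simp: completion_rel_def)
  show "refl_on {X. cauchy_wrt N X} (completion_rel N)"
    by (auto simp: refl_on_def completion_rel_def)
  show "sym (completion_rel N)"
    by (auto simp: sym_def completion_rel_def N_diff_commute)
  show "trans (completion_rel N)"
  proof (rule transI)
    fix X Y Z assume *: "(X, Y) \<in> completion_rel N" "(Y, Z) \<in> completion_rel N"
    then have lim: "(\<lambda>n. N (X n - Y n) + N (Y n - Z n)) \<longlonglongrightarrow> 0 + 0"
      by (intro tendsto_add) (auto simp: completion_rel_def)
    have "(\<lambda>n. N (X n - Z n)) \<longlonglongrightarrow> 0"
      by (rule tendsto_sandwich[OF _ _ tendsto_const lim[simplified]])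
        (auto simp: N_diff_triangle)
    with * show "(X, Z) \<in> completion_rel N"
      by (auto simp: completion_rel_def)
  qed
qed

lemma completionE:
  assumes "\<xi> \<in> completion N"
  obtains X where "cauchy_wrt N X" "\<xi> = cls X"
  using assms unfolding completion_def by (auto elim: quotientE)

lemma cls_in_completion [intro]: "cauchy_wrt N X \<Longrightarrow> cls X \<in> completion N"
  unfolding completion_def by (simp add: quotientI)

lemma cls_eqI: "(X, Y) \<in> completion_rel N \<Longrightarrow> cls X = cls Y"
  by (rule equiv_class_eq[OF equiv_completion_rel])

lemma self_in_cls: "cauchy_wrt N X \<Longrightarrow> X \<in> cls X"
  by (rule equiv_class_self[OF equiv_completion_rel]) simp

lemma completion_embed_in [intro]: "completion_embed N x \<in> completion N"
  unfolding completion_embed_def using cauchy_const by blast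

lemma completion_norm_cls:
  assumes "cauchy_wrt N X" and lim: "(\<lambda>n. N (X n)) \<longlonglongrightarrow> r"
  shows "completion_norm N (cls X) = r"
proof -
  \<comment> \<open>The limit is the same for every representative, so the description in
    \<open>completion_norm\<close> is well defined.\<close>
  have "(\<lambda>n. N (Y n)) \<longlonglongrightarrow> r" if "(X, Y) \<in> completion_rel N" for Y
  proof -
    have "(\<lambda>n. N (X n) - N (Y n)) \<longlonglongrightarrow> 0"
      by (rule Lim_null_comparison[where g = "\<lambda>n. N (X n - Y n)"])
        (use that N_reverse_triangle in \<open>auto simp: completion_rel_def\<close>)
    from tendsto_diff[OF lim this] show ?thesis by simp
  qed
  then show ?thesis
    unfolding completion_norm_def
    by (intro the_equality) (use self_in_cls[OF assms(1)] LIMSEQ_unique[OF lim] in auto)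
qed

lemma completion_norm_embed: "completion_norm N (completion_embed N x) = N x"
  unfolding completion_embed_def by (rule completion_norm_cls) (auto simp: cauchy_const)

lemma completion_add_cls:
  assumes "cauchy_wrt N X" "cauchy_wrt N Y"
  shows "completion_add N (cls X) (cls Y) = cls (\<lambda>n. X n + Y n)"
proof -
  \<comment> \<open>All pairs of representatives give one and the same class, so the union in
    \<open>completion_add\<close> collapses to it.\<close>
  have "cls (\<lambda>n. X' n + Y' n) = cls (\<lambda>n. X n + Y n)" if "X' \<in> cls X" "Y' \<in> cls Y" for X' Y'
  proof (rule cls_eqI[symmetric])
    have lim: "(\<lambda>n. N (X n - X' n) + N (Y n - Y' n)) \<longlonglongrightarrow> 0 + 0"
      using that by (intro tendsto_add) (auto simp: completion_rel_def)
    have "N (X n + Y n - (X' n + Y' n)) \<le> N (X n - X' n) + N (Y n - Y' n)" for n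
      using N_triangle[of "X n - X' n" "Y n - Y' n"] by (simp add: algebra_simps)
    then have "(\<lambda>n. N (X n + Y n - (X' n + Y' n))) \<longlonglongrightarrow> 0"
      by (intro tendsto_sandwich[OF _ _ tendsto_const lim[simplified]]) auto
    then show "(\<lambda>n. X n + Y n, \<lambda>n. X' n + Y' n) \<in> completion_rel N"
      using that assms by (auto simp: completion_rel_def cauchy_add)
  qed
  then show ?thesis
    unfolding completion_add_def using self_in_cls[OF assms(1)] self_in_cls[OF assms(2)] by blast
qed

lemma completion_scale_cls:
  assumes "cauchy_wrt N X"
  shows "completion_scale smul N c (cls X) = cls (\<lambda>n. smul c (X n))"
proof -
  have "cls (\<lambda>n. smul c (X' n)) = cls (\<lambda>n. smul c (X n))" if "X' \<in> cls X" for X'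
  proof (rule cls_eqI[symmetric])
    have "(\<lambda>n. cmod c * N (X n - X' n)) \<longlonglongrightarrow> cmod c * 0"
      using that by (intro tendsto_mult_left) (auto simp: completion_rel_def)
    then have "(\<lambda>n. N (smul c (X n) - smul c (X' n))) \<longlonglongrightarrow> 0"
      by (simp add: N_scale flip: scale_right_diff_distrib)
    then show "(\<lambda>n. smul c (X n), \<lambda>n. smul c (X' n)) \<in> completion_rel N"
      using that assms by (auto simp: completion_rel_def cauchy_scale)
  qed
  then show ?thesis
    unfolding completion_scale_def using self_in_cls[OF assms] by blast
qed

section \<open>Functionals on \<Phi> and on its completion\<close>

definition linear_functional :: "('a \<Rightarrow> complex) \<Rightarrow> bool" where
  "linear_functional f \<longleftrightarrow>
     (\<forall>x y. f (x + y) = f x + f y) \<and> (\<forall>c x. f (smul c x) = c * f x)"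

lemma linear_functional_diff:
  assumes "linear_functional f"
  shows "f (x - y) = f x - f y"
  using assms[unfolded linear_functional_def] by (metis add_diff_cancel diff_add_cancel)

text \<open>The embedded points \<open>X n\<close> approximate \<open>cls X\<close> in the
  completion, and boundedness of \<open>g\<close> carries this over to the values. Hence
  \<open>g\<close> is determined by its restriction to \<Phi>.\<close>

lemma completion_dual_tendsto:
  assumes g: "g \<in> completion_dual smul N" and X: "cauchy_wrt N X"
  shows "(\<lambda>n. g (completion_embed N (X n))) \<longlonglongrightarrow> g (cls X)"
proof (rule LIMSEQ_I)
  fix \<epsilon> :: real assume "\<epsilon> > 0"
  obtain C where C: "\<And>\<xi>. \<xi> \<in> completion N \<Longrightarrow> cmod (g \<xi>) \<le> C * completion_norm N \<xi>"
    using g unfolding completion_dual_def by blast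
  \<comment> \<open>Chosen so that \<open>\<bar>C\<bar> * \<delta> < \<epsilon>\<close> for every
    real \<open>C\<close>, including 0.\<close>
  define \<delta> where "\<delta> = \<epsilon> / (2 * (\<bar>C\<bar> + 1))"
  have "\<delta> > 0" using \<open>\<epsilon> > 0\<close> by (simp add: \<delta>_def add_nonneg_pos)
  then obtain M where M: "\<And>m n. m \<ge> M \<Longrightarrow> n \<ge> M \<Longrightarrow> N (X m - X n) < \<delta>"
    using X unfolding cauchy_wrt_def by meson
  have "norm (g (completion_embed N (X n)) - g (cls X)) < \<epsilon>" if "n \<ge> M" for n
  proof -
    \<comment> \<open>The class of \<open>Y\<close> is the difference of \<open>cls X\<close> and
      the embedded \<open>X n\<close>. Its norm \<open>r\<close> is a limit of numbers that are
      eventually below \<open>\<delta>\<close>.\<close>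
    define Y where "Y = (\<lambda>m. X m + - X n)"
    have Y: "cauchy_wrt N Y"
      unfolding Y_def by (intro cauchy_add X cauchy_const)
    obtain r where r: "(\<lambda>m. N (Y m)) \<longlonglongrightarrow> r"
      using cauchy_norm_convergent[OF Y] by (auto simp: convergent_def)
    have "r \<le> \<delta>"
      by (rule LIMSEQ_le_const2[OF r]) (use M that in \<open>auto simp: Y_def intro!: exI[of _ M] less_imp_le\<close>)
    moreover have "0 \<le> r" by (rule LIMSEQ_le_const[OF r]) auto
    ultimately have "C * r \<le> \<bar>C\<bar> * \<delta>"
      by (meson abs_ge_self abs_ge_zero mult_mono)
    also have "\<dots> < \<epsilon>"
      using \<open>\<epsilon> > 0\<close> by (simp add: \<delta>_def divide_simps add_nonneg_pos)
    finally have small: "C * r < \<epsilon>" .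
    have "cls X = completion_add N (completion_embed N (X n)) (cls Y)"
      unfolding completion_embed_def completion_add_cls[OF cauchy_const Y] by (simp add: Y_def)
    then have "g (cls X) = g (completion_embed N (X n)) + g (cls Y)"
      using g Y by (auto simp: completion_dual_def)
    then have "norm (g (completion_embed N (X n)) - g (cls X)) = cmod (g (cls Y))"
      by simp
    also have "\<dots> \<le> C * r"
      using C[OF cls_in_completion[OF Y]] completion_norm_cls[OF Y r] by simp
    finally show ?thesis using small by simp
  qed
  then show "\<exists>n0. \<forall>n\<ge>n0. norm (g (completion_embed N (X n)) - g (cls X)) < \<epsilon>" by blast
qed

text \<open>Both sides are limits along a Cauchy sequence representing \<open>\<xi>\<close>. This
  reduces the supremum over the completion in \<open>dual_norm\<close> to estimates on \<Phi>
  alone.\<close>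

lemma completion_dual_bound:
  assumes g: "g \<in> completion_dual smul N" and \<xi>: "\<xi> \<in> completion N"
    and bound: "\<And>x. cmod (g (completion_embed N x)) \<le> C * N x"
  shows "cmod (g \<xi>) \<le> C * completion_norm N \<xi>"
proof -
  obtain X where X: "cauchy_wrt N X" "\<xi> = cls X" using \<xi> by (rule completionE)
  obtain r where r: "(\<lambda>n. N (X n)) \<longlonglongrightarrow> r"
    using cauchy_norm_convergent[OF X(1)] by (auto simp: convergent_def)
  have "cmod (g (cls X)) \<le> C * r"
    by (rule LIMSEQ_le[OF tendsto_norm[OF completion_dual_tendsto[OF g X(1)]]
          tendsto_mult_left[OF r]]) (use bound in auto)
  then show ?thesis using completion_norm_cls[OF X(1) r] X(2) by simp
qed

text \<open>Extension by continuity from a dense subspace: a bounded functional sends Cauchy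
  sequences to Cauchy sequences, and \<open>g\<close> takes the limit. It makes every linear
  functional on \<Phi> that is bounded with respect to \<open>N\<close> a member of the Banach
  dual.\<close>

lemma completion_dual_extension:
  assumes f: "linear_functional f" and bound: "\<And>x. cmod (f x) \<le> C * N x"
  obtains g where "g \<in> completion_dual smul N" "f = (\<lambda>x. g (completion_embed N x))"
proof -
  \<comment> \<open>\<open>C\<close> may be negative when \<Phi> is the zero space, so the Cauchy
    estimate is made with its absolute value.\<close>
  have C: "C * N x \<le> \<bar>C\<bar> * N x" for x by (simp add: mult_right_mono)
  have conv: "convergent (\<lambda>n. f (X n))" if X: "cauchy_wrt N X" for X
  proof -
    have "Cauchy (\<lambda>n. f (X n))"
      unfolding Cauchy_def
    proof (intro allI impI)
      fix \<epsilon> :: real assume "\<epsilon> > 0"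
      then have "\<epsilon> / (\<bar>C\<bar> + 1) > 0" by (simp add: add_nonneg_pos)
      then obtain M where M: "\<And>m n. m \<ge> M \<Longrightarrow> n \<ge> M \<Longrightarrow> N (X m - X n) < \<epsilon> / (\<bar>C\<bar> + 1)"
        using X unfolding cauchy_wrt_def by meson
      have "dist (f (X m)) (f (X n)) < \<epsilon>" if "m \<ge> M" "n \<ge> M" for m n
      proof -
        have "dist (f (X m)) (f (X n)) = cmod (f (X m - X n))"
          by (simp add: dist_norm linear_functional_diff[OF f])
        also have "\<dots> \<le> \<bar>C\<bar> * N (X m - X n)" using bound C order_trans by blast
        also have "\<dots> \<le> (\<bar>C\<bar> + 1) * N (X m - X n)" by (simp add: mult_right_mono)
        also have "\<dots> < \<epsilon>"
          using M[OF that] by (simp add: less_divide_eq add_nonneg_pos mult.commute)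
        finally show ?thesis .
      qed
      then show "\<exists>M. \<forall>m\<ge>M. \<forall>n\<ge>M. dist (f (X m)) (f (X n)) < \<epsilon>" by blast
    qed
    then show ?thesis by (simp add: Cauchy_convergent_iff)
  qed
  \<comment> \<open>An arbitrary representative is picked here; the next fact shows that any other
    one leads to the same limit.\<close>
  define g where "g = (\<lambda>\<xi>. lim (\<lambda>n. f ((SOME X. X \<in> \<xi>) n)))"
  have g: "(\<lambda>n. f (X n)) \<longlonglongrightarrow> g (cls X)" if X: "cauchy_wrt N X" for X
  proof -
    define Y where "Y = (SOME Y. Y \<in> cls X)"
    have "Y \<in> cls X" unfolding Y_def by (rule someI[of "\<lambda>Y. Y \<in> cls X", OF self_in_cls[OF X]])
    then have Y: "cauchy_wrt N Y" "(\<lambda>n. N (X n - Y n)) \<longlonglongrightarrow> 0"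
      by (auto simp: completion_rel_def)
    have limY: "(\<lambda>n. f (Y n)) \<longlonglongrightarrow> g (cls X)"
      unfolding g_def Y_def[symmetric] using conv[OF Y(1)] by (simp add: convergent_LIMSEQ_iff)
    have "(\<lambda>n. f (X n) - f (Y n)) \<longlonglongrightarrow> 0"
      by (rule Lim_null_comparison[where g = "\<lambda>n. C * N (X n - Y n)"])
        (use bound tendsto_mult_left[OF Y(2), of C] in
          \<open>auto simp flip: linear_functional_diff[OF f]\<close>)
    from tendsto_add[OF this limY] show ?thesis by simp
  qed
  have embed: "g (completion_embed N x) = f x" for x
    using LIMSEQ_unique[OF g[OF cauchy_const] tendsto_const] by (simp add: completion_embed_def)
  have "g (completion_add N \<xi> \<eta>) = g \<xi> + g \<eta>" if \<xi>: "\<xi> \<in> completion N" and \<eta>: "\<eta> \<in> completion N" for \<xi> \<eta>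
  proof -
    obtain X where X: "cauchy_wrt N X" "\<xi> = cls X" using \<xi> by (rule completionE)
    obtain Y where Y: "cauchy_wrt N Y" "\<eta> = cls Y" using \<eta> by (rule completionE)
    have "(\<lambda>n. f (X n + Y n)) \<longlonglongrightarrow> g \<xi> + g \<eta>"
      using tendsto_add[OF g[OF X(1)] g[OF Y(1)]] f X Y by (simp add: linear_functional_def)
    then show ?thesis
      using LIMSEQ_unique[OF g[OF cauchy_add[OF X(1) Y(1)]]] X Y by (simp add: completion_add_cls)
  qed
  moreover have "g (completion_scale smul N c \<xi>) = c * g \<xi>" if \<xi>: "\<xi> \<in> completion N" for c \<xi>
  proof -
    obtain X where X: "cauchy_wrt N X" "\<xi> = cls X" using \<xi> by (rule completionE)
    have "(\<lambda>n. f (smul c (X n))) \<longlonglongrightarrow> c * g \<xi>"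
      using tendsto_mult_left[OF g[OF X(1)]] f X by (simp add: linear_functional_def)
    then show ?thesis
      using LIMSEQ_unique[OF g[OF cauchy_scale[OF X(1)]]] X by (simp add: completion_scale_cls)
  qed
  moreover have "cmod (g \<xi>) \<le> C * completion_norm N \<xi>" if \<xi>: "\<xi> \<in> completion N" for \<xi>
  proof -
    obtain X where X: "cauchy_wrt N X" "\<xi> = cls X" using \<xi> by (rule completionE)
    obtain r where r: "(\<lambda>n. N (X n)) \<longlonglongrightarrow> r"
      using cauchy_norm_convergent[OF X(1)] by (auto simp: convergent_def)
    have "cmod (g (cls X)) \<le> C * r"
      by (rule LIMSEQ_le[OF tendsto_norm[OF g[OF X(1)]] tendsto_mult_left[OF r]])
        (use bound in auto)
    then show ?thesis using completion_norm_cls[OF X(1) r] X(2) by simp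
  qed
  ultimately have "g \<in> completion_dual smul N"
    unfolding completion_dual_def by blast
  then show thesis using that embed by presburger
qed

section \<open>The Banach dual and its norm, described by estimates on \<Phi>\<close>

lemma banach_dual_linear:
  assumes "f \<in> BD"
  shows "linear_functional f"
proof -
  obtain g where g: "g \<in> completion_dual smul N" "f = (\<lambda>x. g (completion_embed N x))"
    using assms by (auto simp: banach_dual_def)
  have "completion_embed N (x + y) = completion_add N (completion_embed N x) (completion_embed N y)" for x y
    unfolding completion_embed_def by (simp add: completion_add_cls cauchy_const)
  moreover have "completion_embed N (smul c x) = completion_scale smul N c (completion_embed N x)" for c x
    unfolding completion_embed_def by (simp add: completion_scale_cls cauchy_const)
  ultimately show ?thesis
    using g(1) completion_embed_in unfolding linear_functional_def g(2)
    by (simp add: completion_dual_def)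
qed

text \<open>\<open>Sup\<close> is meaningful only for a nonempty set bounded above, so boundedness
  of the values in \<open>dual_norm\<close> comes first. The estimate on the unit ball then extends
  to all \<open>x\<close> by scaling.\<close>

lemma dual_norm_bound:
  assumes "f \<in> BD"
  shows "0 \<le> dn f" "cmod (f x) \<le> dn f * N x"
proof -
  obtain g where g: "g \<in> completion_dual smul N" "f = (\<lambda>x. g (completion_embed N x))"
    using assms by (auto simp: banach_dual_def)
  obtain C where C: "\<And>\<xi>. \<xi> \<in> completion N \<Longrightarrow> cmod (g \<xi>) \<le> C * completion_norm N \<xi>"
    using g unfolding completion_dual_def by blast
  let ?S = "{cmod (g \<xi>) | g \<xi>. g \<in> completion_dual smul N \<and> f = (\<lambda>x. g (completion_embed N x)) \<and>
                            \<xi> \<in> completion N \<and> completion_norm N \<xi> \<le> 1}"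
  have fC: "cmod (f x) \<le> \<bar>C\<bar> * N x" for x
  proof -
    have "cmod (f x) \<le> C * N x"
      using C[OF completion_embed_in, of x] by (simp add: g(2) completion_norm_embed)
    then show ?thesis by (meson N_nonneg abs_ge_self mult_right_mono order_trans)
  qed
  \<comment> \<open>The supremum ranges over all extensions \<open>h\<close> of \<open>f\<close>.
    Each is controlled by its values on \<Phi>, which are those of \<open>f\<close>, so the constant
    obtained from \<open>g\<close> serves for all of them.\<close>
  have bdd: "bdd_above ?S"
  proof (rule bdd_aboveI[of _ "\<bar>C\<bar>"], safe)
    fix h \<xi>
    assume h: "h \<in> completion_dual smul N" "f = (\<lambda>x. h (completion_embed N x))"
      and \<xi>: "\<xi> \<in> completion N" "completion_norm N \<xi> \<le> 1"
    have "cmod (h \<xi>) \<le> \<bar>C\<bar> * completion_norm N \<xi>"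
      by (rule completion_dual_bound[OF h(1) \<xi>(1)]) (use fC h(2) in metis)
    also have "\<dots> \<le> \<bar>C\<bar>" using \<xi>(2) by (simp add: mult_left_le)
    finally show "cmod (h \<xi>) \<le> \<bar>C\<bar>" .
  qed
  have le: "cmod (f x) \<le> dn f" if "N x \<le> 1" for x
    unfolding dual_norm_def
    by (rule cSup_upper[OF _ bdd])
      (use that g completion_embed_in completion_norm_embed in \<open>auto intro!: exI[of _ g] exI[of _ "completion_embed N x"]\<close>)
  show "0 \<le> dn f" using le[of 0] by (metis N_zero norm_ge_zero order_trans zero_le_one)
  show "cmod (f x) \<le> dn f * N x"
  proof (cases "x = 0")
    case True
    then show ?thesis using fC[of x] by simp
  next
    case False
    then have pos: "N x > 0" using N_nonneg[of x] N_eq_0_iff[of x] by linarith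
    let ?y = "smul (complex_of_real (1 / N x)) x"
    have "N ?y = 1" using False by (simp add: N_scale norm_divide)
    then have "cmod (f ?y) \<le> dn f" using le by simp
    moreover have "f ?y = complex_of_real (1 / N x) * f x"
      using banach_dual_linear[OF assms] by (simp add: linear_functional_def)
    ultimately show ?thesis using pos by (simp add: norm_mult norm_divide field_simps)
  qed
qed

lemma banach_dualI:
  assumes f: "linear_functional f" and bound: "\<And>x. cmod (f x) \<le> C * N x"
  shows "f \<in> BD"
  using completion_dual_extension[OF f bound] unfolding banach_dual_def by blast

text \<open>The bound passes from \<Phi> to every extension and so to the supremum. The condition
  \<open>0 \<le> C\<close> excludes negative constants on the zero space, where the estimate on
  \<open>f\<close> holds for any \<open>C\<close>.\<close>

lemma dual_norm_le:
  assumes f: "linear_functional f" and bound: "\<And>x. cmod (f x) \<le> C * N x" and "0 \<le> C"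
  shows "dn f \<le> C"
  unfolding dual_norm_def
proof (rule cSup_least)
  obtain g where g: "g \<in> completion_dual smul N" "f = (\<lambda>x. g (completion_embed N x))"
    using completion_dual_extension[OF f bound] .
  moreover have "completion_norm N (completion_embed N 0) \<le> 1"
    using completion_norm_embed[of 0] by simp
  ultimately show "{cmod (g \<xi>) | g \<xi>. g \<in> completion_dual smul N \<and> f = (\<lambda>x. g (completion_embed N x)) \<and>
                            \<xi> \<in> completion N \<and> completion_norm N \<xi> \<le> 1} \<noteq> {}"
    using completion_embed_in[of 0] by blast
next
  fix r
  assume "r \<in> {cmod (g \<xi>) | g \<xi>. g \<in> completion_dual smul N \<and> f = (\<lambda>x. g (completion_embed N x)) \<and>
                            \<xi> \<in> completion N \<and> completion_norm N \<xi> \<le> 1}"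
  then obtain h \<xi> where h: "h \<in> completion_dual smul N" "f = (\<lambda>x. h (completion_embed N x))"
      and \<xi>: "\<xi> \<in> completion N" "completion_norm N \<xi> \<le> 1" and r: "r = cmod (h \<xi>)"
    by blast
  have "cmod (h \<xi>) \<le> C * completion_norm N \<xi>"
    by (rule completion_dual_bound[OF h(1) \<xi>(1)]) (use bound h(2) in metis)
  also have "\<dots> \<le> C" using \<xi>(2) \<open>0 \<le> C\<close> by (simp add: mult_left_le)
  finally show "r \<le> C" using r by simp
qed

lemma banach_dual_add:
  assumes "f \<in> BD" "g \<in> BD"
  shows "f + g \<in> BD" "dn (f + g) \<le> dn f + dn g"
proof -
  have lin: "linear_functional (f + g)"
    using assms[THEN banach_dual_linear] by (simp add: linear_functional_def algebra_simps)
  have b: "cmod ((f + g) x) \<le> (dn f + dn g) * N x" for x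
    using dual_norm_bound(2)[OF assms(1), of x] dual_norm_bound(2)[OF assms(2), of x]
      norm_triangle_ineq[of "f x" "g x"] by (simp add: algebra_simps)
  show "f + g \<in> BD" by (rule banach_dualI[OF lin b])
  show "dn (f + g) \<le> dn f + dn g"
    by (rule dual_norm_le[OF lin b]) (simp add: dual_norm_bound assms)
qed

lemma banach_dual_uminus:
  assumes "f \<in> BD"
  shows "- f \<in> BD" "dn (- f) \<le> dn f"
proof -
  have lin: "linear_functional (- f)"
    using assms[THEN banach_dual_linear] by (simp add: linear_functional_def)
  have b: "cmod ((- f) x) \<le> dn f * N x" for x
    using dual_norm_bound(2)[OF assms, of x] by simp
  show "- f \<in> BD" by (rule banach_dualI[OF lin b])
  show "dn (- f) \<le> dn f"
    by (rule dual_norm_le[OF lin b]) (simp add: dual_norm_bound assms)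
qed

lemma banach_dual_diff:
  assumes "f \<in> BD" "g \<in> BD"
  shows "f - g \<in> BD" "dn (f - g) \<le> dn f + dn g"
  using banach_dual_add[OF assms(1) banach_dual_uminus(1)[OF assms(2)]]
    banach_dual_uminus(2)[OF assms(2)] by auto

section \<open>Geometric and Neumann series in the Banach dual\<close>

text \<open>This plays the role of completeness of the dual. At each \<open>x\<close> the series is
  dominated by the scalar geometric series with terms \<open>c * N x * k ^ n\<close>, so the
  pointwise sum is linear and bounded by the sum of that series.\<close>

lemma banach_dual_geometric_series:
  assumes t: "\<And>n. t n \<in> BD" "\<And>n. dn (t n) \<le> c * k ^ n" and k: "0 \<le> k" "k < 1"
  shows "summable (\<lambda>n. t n x)" "(\<lambda>x. \<Sum>n. t n x) \<in> BD" "dn (\<lambda>x. \<Sum>n. t n x) \<le> c / (1 - k)"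
proof -
  have le: "cmod (t n x) \<le> c * N x * k ^ n" for n x
    using dual_norm_bound(2)[OF t(1), of n x] mult_right_mono[OF t(2) N_nonneg, of n x]
    by (simp add: mult_ac)
  have sum: "(\<lambda>n. c * N x * k ^ n) sums (c * N x * (1 / (1 - k)))" for x
    by (intro sums_mult geometric_sums) (use k in auto)
  show summ: "summable (\<lambda>n. t n x)" for x
    by (rule summable_comparison_test[OF _ sums_summable[OF sum]]) (use le in blast)
  have lin: "linear_functional (\<lambda>x. \<Sum>n. t n x)"
    using t(1)[THEN banach_dual_linear]
    by (simp add: linear_functional_def suminf_add suminf_mult summ)
  have b: "cmod (\<Sum>n. t n x) \<le> c / (1 - k) * N x" for x
    using norm_suminf_le[OF le sums_summable[OF sum]] sums_unique[OF sum, of x]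
    by (simp add: mult_ac)
  \<comment> \<open>The instance n = 0 of the bound on \<open>t\<close>, where the power of
    \<open>k\<close> is 1.\<close>
  have "0 \<le> c"
    using dual_norm_bound(1)[OF t(1), of 0] t(2)[of 0] by simp
  then have c: "0 \<le> c / (1 - k)" using k by simp
  show "(\<lambda>x. \<Sum>n. t n x) \<in> BD" by (rule banach_dualI[OF lin b])
  show "dn (\<lambda>x. \<Sum>n. t n x) \<le> c / (1 - k)" by (rule dual_norm_le[OF lin b c])
qed

text \<open>The solution is the sum of all iterates of \<open>L\<close> at \<open>a\<close>.
  Additivity moves \<open>L\<close> past finitely many terms only; to pass to the whole series, the
  error of applying \<open>L\<close> termwise is shown to be unchanged when initial terms are split
  off, while the norms of the tails tend to 0.\<close>

lemma neumann_series:
  assumes L: "\<And>f. f \<in> BD \<Longrightarrow> L f \<in> BD" "\<And>f. f \<in> BD \<Longrightarrow> dn (L f) \<le> k * dn f"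
      "\<And>f g. f \<in> BD \<Longrightarrow> g \<in> BD \<Longrightarrow> L (f + g) = L f + L g"
    and k: "0 \<le> k" "k < 1" and a: "a \<in> BD"
  obtains s where "s \<in> BD" "s = a + L s" "dn s \<le> dn a / (1 - k)"
proof -
  define t where "t n = (L ^^ n) a" for n
  have tS: "t (Suc n) = L (t n)" for n by (simp add: t_def)
  have t: "t n \<in> BD \<and> dn (t n) \<le> dn a * k ^ n" for n
  proof (induction n)
    case 0
    then show ?case by (simp add: t_def a)
  next
    case (Suc n)
    then have "k * dn (t n) \<le> k * (dn a * k ^ n)" using k by (simp add: mult_left_mono)
    then show ?case using Suc L(1,2)[of "t n"] by (simp add: tS mult_ac)
  qed
  \<comment> \<open>\<open>r m\<close> is the tail of the series from index \<open>m\<close>;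
    \<open>r 0\<close> is the solution sought.\<close>
  define r where "r m = (\<lambda>x. \<Sum>n. t (n + m) x)" for m
  have tail: "t (n + m) \<in> BD" "dn (t (n + m)) \<le> dn a * k ^ m * k ^ n" for n m
    using t[of "n + m"] by (simp_all add: power_add mult_ac)
  note series = banach_dual_geometric_series[of "\<lambda>n. t (n + m)" for m, OF tail k]
  have r: "r m \<in> BD" "dn (r m) \<le> dn a * k ^ m / (1 - k)" for m
    unfolding r_def using series(2,3) by blast+
  have r_Suc: "r m = t m + r (Suc m)" for m
    using suminf_split_head[OF series(1), of m] by (auto simp: r_def fun_eq_iff)
  \<comment> \<open>\<open>D\<close> measures the failure of \<open>L\<close> to act termwise on the
    series; the aim is \<open>D = 0\<close>.\<close>
  define D where "D = L (r 0) - r 1"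
  have D: "D = L (r m) - r (Suc m)" for m
  proof (induction m)
    case 0
    then show ?case by (simp add: D_def)
  next
    case (Suc m)
    \<comment> \<open>By additivity the head \<open>t m\<close> contributes
      \<open>t (Suc m)\<close>, which cancels against the head of \<open>r (Suc m)\<close>.\<close>
    have "L (r m) = L (t m + r (Suc m))" using r_Suc by metis
    also have "\<dots> = t (Suc m) + L (r (Suc m))" by (simp add: L(3) t r tS)
    finally have "D = t (Suc m) + L (r (Suc m)) - r (Suc m)" by (simp only: Suc)
    also have "\<dots> = t (Suc m) + L (r (Suc m)) - (t (Suc m) + r (Suc (Suc m)))"
      using r_Suc[of "Suc m"] by metis
    finally show ?case by simp
  qed
  have DBD: "D \<in> BD" unfolding D_def by (intro banach_dual_diff L r)
  \<comment> \<open>Both tails in the m-th expression for \<open>D\<close> are of order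
    \<open>k ^ m\<close>, whereas \<open>D\<close> itself is fixed; letting \<open>m\<close> grow
    forces its norm to vanish.\<close>
  have "dn D \<le> 2 * dn a / (1 - k) * k ^ m" for m
  proof -
    have "dn D \<le> dn (L (r m)) + dn (r (Suc m))"
      unfolding D[of m] by (intro banach_dual_diff L r)
    also have "\<dots> \<le> k * (dn a * k ^ m / (1 - k)) + dn a * k ^ Suc m / (1 - k)"
      using L(2)[OF r(1), of m] mult_left_mono[OF r(2) k(1), of m] r(2)[of "Suc m"] by linarith
    also have "\<dots> = 2 * dn a / (1 - k) * k ^ m * k" by simp
    also have "\<dots> \<le> 2 * dn a / (1 - k) * k ^ m"
      by (rule mult_left_le) (use k dual_norm_bound(1)[OF a] in auto)
    finally show ?thesis .
  qed
  moreover have "(\<lambda>m. 2 * dn a / (1 - k) * k ^ m) \<longlonglongrightarrow> 2 * dn a / (1 - k) * 0"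
    using k by (intro tendsto_mult_left LIMSEQ_power_zero) auto
  ultimately have "dn D \<le> 0" by (metis LIMSEQ_le_const mult_zero_right)
  then have "cmod (D x) \<le> 0" for x
    using dual_norm_bound(2)[OF DBD, of x] by (meson N_nonneg mult_nonpos_nonneg order_trans)
  then have "D = 0" by (auto simp: fun_eq_iff)
  then have "L (r 0) = r 1" by (simp add: D_def)
  then have "r 0 = a + L (r 0)" using r_Suc[of 0] by (simp add: t_def)
  then show thesis using that[of "r 0"] r[of 0] by simp
qed

end

section \<open>The increasing scale of duals and its union\<close>

lemma banach_dual_mono:
  assumes "countably_normed_space smul nrm" "p \<le> q"
  shows "banach_dual smul (nrm p) \<subseteq> banach_dual smul (nrm q)"
proof
  fix f assume f: "f \<in> banach_dual smul (nrm p)"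
  interpret P: complex_norm smul "nrm p"
    using assms by (simp add: countably_normed_space_def complex_norm_def complex_norm_axioms_def)
  interpret Q: complex_norm smul "nrm q"
    using assms by (simp add: countably_normed_space_def complex_norm_def complex_norm_axioms_def)
  have mono: "nrm p x \<le> nrm q x" for x
    by (rule lift_Suc_mono_le[of "\<lambda>p. nrm p x", OF _ \<open>p \<le> q\<close>])
      (use assms in \<open>simp add: countably_normed_space_def\<close>)
  show "f \<in> banach_dual smul (nrm q)"
  proof (rule Q.banach_dualI[OF P.banach_dual_linear[OF f]])
    show "cmod (f x) \<le> dual_norm smul (nrm p) f * nrm q x" for x
      using P.dual_norm_bound[OF f] mono by (meson mult_left_mono order_trans)
  qed
qed

text \<open>Since the duals increase, two functionals lie at a common level, where closure of the
  Banach dual applies.\<close>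

lemma dual_union_closed:
  assumes cn: "countably_normed_space smul nrm"
    and f: "f \<in> dual_union smul nrm" and g: "g \<in> dual_union smul nrm"
  shows "f + g \<in> dual_union smul nrm" "f - g \<in> dual_union smul nrm"
proof -
  obtain p q where "f \<in> banach_dual smul (nrm p)" "g \<in> banach_dual smul (nrm q)"
    using f g by (auto simp: dual_union_def)
  then have fg: "f \<in> banach_dual smul (nrm (max p q))" "g \<in> banach_dual smul (nrm (max p q))"
    using banach_dual_mono[OF cn] by (meson max.cobounded1 max.cobounded2 subsetD)+
  interpret complex_norm smul "nrm (max p q)"
    using cn by (simp add: countably_normed_space_def complex_norm_def complex_norm_axioms_def)
  show "f + g \<in> dual_union smul nrm" "f - g \<in> dual_union smul nrm"
    using banach_dual_add(1)[OF fg] banach_dual_diff(1)[OF fg] by (auto simp: dual_union_def)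
qed

section \<open>The two-sided inverse and its estimates\<close>

theorem theorem2p6:
  fixes smul :: "complex \<Rightarrow> 'a \<Rightarrow> 'a::ab_group_add"
    and nrm :: "nat \<Rightarrow> 'a \<Rightarrow> real"
    and mul :: "('a \<Rightarrow> complex) \<Rightarrow> ('a \<Rightarrow> complex) \<Rightarrow> ('a \<Rightarrow> complex)"
    and e a :: "'a \<Rightarrow> complex"
    and d p q :: nat
    and A :: "nat \<Rightarrow> nat \<Rightarrow> real"
  assumes "strong_algebra smul nrm mul d A"
    and "algebra_unit (dual_union smul nrm) mul e"
    and "p > q + d"
    and "a \<in> banach_dual smul (nrm q)"
    and "A p q * dual_norm smul (nrm q) a < 1"
  shows "\<exists>b \<in> dual_union smul nrm. mul (e - a) b = e \<and> mul b (e - a) = e \<and>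
     (e \<in> banach_dual smul (nrm p) \<and> dual_norm smul (nrm p) e \<le> 1 \<longrightarrow>
        b \<in> banach_dual smul (nrm p) \<and>
        dual_norm smul (nrm p) b \<le> 1 / (1 - A p q * dual_norm smul (nrm q) a) \<and>
        e - b \<in> banach_dual smul (nrm p) \<and>
        dual_norm smul (nrm p) (e - b)
          \<le> A p q * dual_norm smul (nrm q) a / (1 - A p q * dual_norm smul (nrm q) a))"
proof -
  let ?U = "dual_union smul nrm" and ?B = "banach_dual smul (nrm p)" and ?dn = "dual_norm smul (nrm p)"
  define k where "k = A p q * dual_norm smul (nrm q) a"
  have cn: "countably_normed_space smul nrm" and prod: "algebra_product ?U mul"
    using assms(1) by (auto simp: strong_algebra_def)
  have Apos: "A p q > 0"
    and mul: "\<And>f. f \<in> ?B \<Longrightarrow> mul a f \<in> ?B" "\<And>f. f \<in> ?B \<Longrightarrow> mul f a \<in> ?B"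
      "\<And>f. f \<in> ?B \<Longrightarrow> ?dn (mul a f) \<le> k * ?dn f" "\<And>f. f \<in> ?B \<Longrightarrow> ?dn (mul f a) \<le> k * ?dn f"
    using assms(1,3,4) unfolding strong_algebra_def k_def by blast+
  interpret Q: complex_norm smul "nrm q"
    using cn by (simp add: countably_normed_space_def complex_norm_def complex_norm_axioms_def)
  interpret P: complex_norm smul "nrm p"
    using cn by (simp add: countably_normed_space_def complex_norm_def complex_norm_axioms_def)
  have k: "0 \<le> k" "k < 1"
    using Apos Q.dual_norm_bound(1)[OF assms(4)] assms(5) by (auto simp: k_def)
  have aB: "a \<in> ?B"
    using banach_dual_mono[OF cn, of q p] assms(3,4) by auto
  have BU: "f \<in> ?U" if "f \<in> ?B" for f using that by (auto simp: dual_union_def)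
  have eU: "e \<in> ?U" and unit: "\<And>f. f \<in> ?U \<Longrightarrow> mul e f = f" "\<And>f. f \<in> ?U \<Longrightarrow> mul f e = f"
    using assms(2) by (auto simp: algebra_unit_def)
  note closed = dual_union_closed[OF cn]
  have mulU: "mul f g \<in> ?U" if "f \<in> ?U" "g \<in> ?U" for f g
    using prod that unfolding algebra_product_def by blast
  have assoc: "mul (mul f g) h = mul f (mul g h)" if "f \<in> ?U" "g \<in> ?U" "h \<in> ?U" for f g h
    using prod that unfolding algebra_product_def by blast
  have distl: "mul (f + g) h = mul f h + mul g h" if "f \<in> ?U" "g \<in> ?U" "h \<in> ?U" for f g h
    using prod that unfolding algebra_product_def by blast
  have distr: "mul f (g + h) = mul f g + mul f h" if "f \<in> ?U" "g \<in> ?U" "h \<in> ?U" for f g h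
    using prod that unfolding algebra_product_def by blast
  \<comment> \<open>Additivity applied to \<open>f = (f - g) + g\<close>.\<close>
  have diffl: "mul (f - g) h = mul f h - mul g h" if "f \<in> ?U" "g \<in> ?U" "h \<in> ?U" for f g h
    using distl[of "f - g" g h] closed(2) that by (simp add: algebra_simps)
  have diffr: "mul h (f - g) = mul h f - mul h g" if "f \<in> ?U" "g \<in> ?U" "h \<in> ?U" for f g h
    using distr[of h "f - g" g] closed(2) that by (simp add: algebra_simps)
  obtain s where s: "s \<in> ?B" "s = a + mul a s" "?dn s \<le> ?dn a / (1 - k)"
    by (rule P.neumann_series[of "mul a", OF mul(1,3) _ k aB]) (auto simp: distr BU aB)
  \<comment> \<open>Only membership and the algebraic identity are kept for \<open>s'\<close>; the
    estimates will come from \<open>s\<close> once the two inverses agree.\<close>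
  obtain s' where s': "s' \<in> ?B" "s' = a + mul s' a"
    by (rule P.neumann_series[of "\<lambda>f. mul f a", OF mul(2,4) _ k aB]) (auto simp: distl BU aB)
  have U: "a \<in> ?U" "s \<in> ?U" "s' \<in> ?U" "e - a \<in> ?U" "e + s \<in> ?U" "e + s' \<in> ?U"
    using BU aB s(1) s'(1) eU closed by auto
  have right: "mul (e - a) (e + s) = e"
  proof -
    have "mul (e - a) (e + s) = e + s - (a + mul a s)"
      using U eU by (simp add: diffl distr unit)
    then show ?thesis using s(2) by simp
  qed
  have left: "mul (e + s') (e - a) = e"
  proof -
    have "mul (e + s') (e - a) = e + s' - (a + mul s' a)"
      using U eU by (simp add: diffr distl unit)
    then show ?thesis using s'(2) by simp
  qed
  \<comment> \<open>A left inverse equals a right inverse: the triple product with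
    \<open>e - a\<close> in the middle is bracketed in both ways.\<close>
  have "e + s' = mul (e + s') (mul (e - a) (e + s))" using U right unit by simp
  also have "\<dots> = e + s" using U left unit by (simp flip: assoc)
  finally have left': "mul (e + s) (e - a) = e" using left by simp
  \<comment> \<open>For \<open>a = 0\<close> the inverse is \<open>e\<close> and the first estimate
    reads \<open>?dn e \<le> 1\<close>, so a normalization of the unit in
    \<open>\<Phi>\<^sub>p'\<close> is what the estimates rest on.\<close>
  have bounds: "e + s \<in> ?B \<and> ?dn (e + s) \<le> 1 / (1 - k) \<and> e - (e + s) \<in> ?B \<and> ?dn (e - (e + s)) \<le> k / (1 - k)"
    if e: "e \<in> ?B" "?dn e \<le> 1"
  proof -
    \<comment> \<open>Writing \<open>a\<close> as its product with the unit brings in the factor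
      \<open>A p q\<close> and bounds the norm of \<open>a\<close> at level \<open>p\<close> by
      \<open>k\<close>.\<close>
    have "?dn a = ?dn (mul a e)" using U unit by simp
    also have "\<dots> \<le> k * ?dn e" using mul(3) e by blast
    also have "\<dots> \<le> k" using e k by (simp add: mult_left_le)
    finally have "?dn a / (1 - k) \<le> k / (1 - k)" using k by (simp add: divide_right_mono)
    then have sk: "?dn s \<le> k / (1 - k)" using s(3) by simp
    \<comment> \<open>The bound 1 on \<open>e\<close> and the bound on \<open>s\<close> add up to
      the first estimate; the second follows from \<open>e - (e + s) = - s\<close>.\<close>
    moreover have "1 + k / (1 - k) = 1 / (1 - k)" using k by (simp add: field_simps)
    ultimately show ?thesis
      using P.banach_dual_add[OF e(1) s(1)] P.banach_dual_uminus[OF s(1)] e(2) by auto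
  qed
  show ?thesis
    using U(5) right left' bounds unfolding k_def by blast
qed

end
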